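(* Let $a<b$ be reals, $d,N\in\mathbb{N}^*$ and $0<\alpha\le1$. Let $L:\mathbb{R}^d\times\mathbb{R}^d\times[a,b]\to\mathbb{R}$, $(x,v,t)\mapsto L(x,v,t)$, be a Lagrangian (a map of class $\mathscr{C}^2$) which is $\Delta^\alpha_-$-invariant under the action of a one parameter group of diffeomorphisms $\Phi=\{\phi(s,\cdot)\}_{s\in\mathbb{R}}$ of $\mathbb{R}^d$. Then, for any solution $Q\in(\mathbb{R}^d)^{N+1}$ of the discrete fractional Euler-Lagrange equation $$\frac{\partial L}{\partial x}(Q,\Delta^\alpha_-Q,\tau)+\Delta^\alpha_+\left(\frac{\partial L}{\partial v}(Q,\Delta^\alpha_-Q,\tau)\right)=0,$$ the following equality holds: $$\Delta^1_-\left[\sum_{r=1}^{N-1}\alpha_r\,A_r\left(\frac{\partial\phi}{\partial s}(0,Q)\cdot\sigma^r\Big(\frac{\partial L}{\partial v}(Q,\Delta^\alpha_-Q,\tau)\Big)\right)\right]=0.$$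
   Context: $\mathbb{N}^*$ is the set of positive integers. Let $h=(b-a)/N$, $t_k=a+kh$ and $\tau=(t_k)_{k=0,\dots,N}$. Coefficients. $\alpha_0=1$ and $\alpha_r=\dfrac{(-\alpha)(1-\alpha)\cdots(r-1-\alpha)}{r!}$ for $r\in\mathbb{N}^*$. Discrete fractional derivatives. $\Delta^\alpha_-$ and $\Delta^\alpha_+$ map $(\mathbb{R}^d)^{N+1}$ to $(\mathbb{R}^d)^{N}$: for $Q=(Q_k)_{k=0,\dots,N}$, $$\Delta^\alpha_-Q=\left(\frac{1}{h^\alpha}\sum_{r=0}^{k}\alpha_rQ_{k-r}\right)_{k=1,\dots,N},\qquad\Delta^\alpha_+Q=\left(\frac{1}{h^\alpha}\sum_{r=0}^{N-k}\alpha_rQ_{k+r}\right)_{k=0,\dots,N-1}.$$ In particular (case $\alpha=1$, real-valued sequences), for $X\in\mathbb{R}^{N+1}$, $\Delta^1_-X=\big((X_k-X_{k-1})/h\big)_{k=1,\dots,N}\in\mathbb{R}^N$. Componentwise conventions. Functions of $(Q,\Delta^\alpha_-Q,\tau)$ are evaluated componentwise: the $k$-th component of $\frac{\partial L}{\partial v}(Q,\Delta^\alpha_-Q,\tau)$ is $\frac{\partial L}{\partial v}(Q_k,(\Delta^\alpha_-Q)_k,t_k)$ for $k=1,\dots,N$, and likewise for $L$ and $\frac{\partial L}{\partial x}$. Similarly $\phi(s,Q)=(\phi(s,Q_k))_{k=0,\dots,N}$ and $\frac{\partial\phi}{\partial s}(0,Q)=\big(\frac{\partial\phi}{\partial s}(0,Q_k)\big)_{k=0,\dots,N}$.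 The discrete fractional Euler-Lagrange equation is understood at the indices $k=1,\dots,N-1$, where both of its terms are defined. For $F,G\in(\mathbb{R}^d)^{N+1}$, $F\cdot G=(F_k\cdot G_k)_{k=0,\dots,N}\in\mathbb{R}^{N+1}$, where $\cdot$ is the Euclidean scalar product. Shift. $\sigma:(\mathbb{R}^d)^{N+1}\to(\mathbb{R}^d)^{N+1}$, $\sigma(Q)=(Q_{k+1})_{k=0,\dots,N}$ with the convention $Q_{N+1}=0$; $\sigma^r$ is its $r$-th iterate. (For $r\ge1$, $\sigma^r(G)$ does not involve $G_0$, so it makes sense for a sequence $G$ indexed by $k=1,\dots,N$.) Matrices. The $A_r$ are real square matrices of size $N+1$ with rows and columns indexed by $0,\dots,N$, acting on $\mathbb{R}^{N+1}$. $A_1=-\mathrm{Id}_{N+1}$, and for $r\in\{2,\dots,N-1\}$ and $i,j=0,\dots,N$: $$(A_r)_{i,j}=\begin{cases}0&\text{if }i=0,\\ \delta_{\{j=0\}}\delta_{\{r\le i\}}-\delta_{\{0\le i-j\le r-1\}}\delta_{\{1\le j\le N-r\}}&\text{if }1\le i\le N-1,\\ (A_r)_{N-1,j}&\text{if }i=N,\end{cases}$$ where $\delta_{\{P\}}$ equals $1$ if $P$ is true and $0$ otherwise. One parameter group of diffeomorphisms. $\Phi=\{\phi(s,\cdot)\}_{s\in\mathbb{R}}$ is a family of diffeomorphisms $\phi(s,\cdot):\mathbb{R}^d\to\mathbb{R}^d$ such that $\phi(0,\cdot)=\mathrm{Id}_{\mathbb{R}^d}$, $\phi(s,\cdot)\circ\phi(s',\cdot)=\phi(s+s',\cdot)$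 for all $s,s'\in\mathbb{R}$, and $\phi$ is of class $\mathscr{C}^2$. Invariance. $L$ is $\Delta^\alpha_-$-invariant under the action of $\Phi$ if for every solution $Q$ of the discrete fractional Euler-Lagrange equation displayed in the claim and every $s\in\mathbb{R}$, $$L\Big(\phi(s,Q),\Delta^\alpha_-\big(\phi(s,Q)\big),\tau\Big)=L\big(Q,\Delta^\alpha_-Q,\tau\big)$$ (componentwise, for $k=1,\dots,N$).
   Formalization: The equality is stated only for the components k=1,…,N-1 of Δ^1_-; the component k=N is dropped because it is false in general for N≥2 (e.g. d=1, [a,b]=[0,2], N=2, α=1, L=v²/2, φ(s,x)=x+s, Q_k=k gives -1), and for N=1 it is trivially 0. *)

theory Defs
  imports "HOL-Analysis.Analysis"
begin

text \<open>
  Differentiability is taken within \<open>S\<close>. For \<open>S = UNIV \<times> UNIV \<times> {a..b}\<close> with \<open>a < b\<close> derivatives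
  within \<open>S\<close> are unique, and at \<open>t = a\<close> and \<open>t = b\<close> they are one-sided in \<open>t\<close>.
\<close>

definition C1_on :: "'a::real_normed_vector set \<Rightarrow> ('a \<Rightarrow> 'b::real_normed_vector) \<Rightarrow> bool" where
  "C1_on S f \<longleftrightarrow>
     (\<exists>f' :: 'a \<Rightarrow> 'a \<Rightarrow>\<^sub>L 'b.
        (\<forall>x\<in>S. (f has_derivative blinfun_apply (f' x)) (at x within S)) \<and> continuous_on S f')"

definition C2_on :: "'a::real_normed_vector set \<Rightarrow> ('a \<Rightarrow> 'b::real_normed_vector) \<Rightarrow> bool" where
  "C2_on S f \<longleftrightarrow>
     (\<exists>f' :: 'a \<Rightarrow> 'a \<Rightarrow>\<^sub>L 'b.
        (\<forall>x\<in>S. (f has_derivative blinfun_apply (f' x)) (at x within S)) \<and> C1_on S f')"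

definition diffeomorphism :: "('a::real_normed_vector \<Rightarrow> 'a) \<Rightarrow> bool" where
  "diffeomorphism f \<longleftrightarrow> bij f \<and> C1_on UNIV f \<and> C1_on UNIV (inv f)"

definition one_param_group :: "(real \<Rightarrow> real^'d \<Rightarrow> real^'d) \<Rightarrow> bool" where
  "one_param_group \<phi> \<longleftrightarrow>
     (\<forall>s. diffeomorphism (\<phi> s)) \<and> \<phi> 0 = id \<and> (\<forall>s s'. \<phi> s \<circ> \<phi> s' = \<phi> (s + s')) \<and>
     C2_on UNIV (\<lambda>(s, x). \<phi> s x)"

definition dphi0 :: "(real \<Rightarrow> real^'d \<Rightarrow> real^'d) \<Rightarrow> real^'d \<Rightarrow> real^'d" where
  "dphi0 \<phi> x = vector_derivative (\<lambda>s. \<phi> s x) (at 0)"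

definition lagrangian :: "real \<Rightarrow> real \<Rightarrow> (real^'d \<Rightarrow> real^'d \<Rightarrow> real \<Rightarrow> real) \<Rightarrow> bool" where
  "lagrangian a b L \<longleftrightarrow> C2_on (UNIV \<times> UNIV \<times> {a..b}) (\<lambda>(x, v, t). L x v t)"

definition gradient :: "('a::real_inner \<Rightarrow> real) \<Rightarrow> 'a \<Rightarrow> 'a" where
  "gradient f x = (THE D. GDERIV f x :> D)"

definition dL_dx :: "(real^'d \<Rightarrow> real^'d \<Rightarrow> real \<Rightarrow> real) \<Rightarrow> real^'d \<Rightarrow> real^'d \<Rightarrow> real \<Rightarrow> real^'d" where
  "dL_dx L x v t = gradient (\<lambda>y. L y v t) x"

definition dL_dv :: "(real^'d \<Rightarrow> real^'d \<Rightarrow> real \<Rightarrow> real) \<Rightarrow> real^'d \<Rightarrow> real^'d \<Rightarrow> real \<Rightarrow> real^'d" where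
  "dL_dv L x v t = gradient (\<lambda>w. L x w t) v"

definition step :: "real \<Rightarrow> real \<Rightarrow> nat \<Rightarrow> real" where
  "step a b N = (b - a) / real N"

definition node :: "real \<Rightarrow> real \<Rightarrow> nat \<Rightarrow> nat \<Rightarrow> real" where
  "node a b N k = a + real k * step a b N"

text \<open>
  \<open>pochhammer (-\<alpha>) r = (-\<alpha>) (1 - \<alpha>) \<dots> (r - 1 - \<alpha>)\<close>, which is \<open>1\<close> for \<open>r = 0\<close>.
\<close>

definition frac_coeff :: "real \<Rightarrow> nat \<Rightarrow> real" where
  "frac_coeff \<alpha> r = pochhammer (-\<alpha>) r / fact r"

text \<open>
  A finite sequence indexed by \<open>0, \<dots>, N\<close> (or by \<open>1, \<dots>, N\<close>) is a function on \<^typ>\<open>nat\<close> of which only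
  the values at these indices matter. \<open>frac_minus\<close> is meaningful at \<open>k \<in> {1..N}\<close>, \<open>frac_plus\<close> at
  \<open>k \<in> {0..<N}\<close>; \<open>frac_plus\<close> at \<open>k\<close> reads its argument at \<open>k, \<dots>, N\<close> only.
\<close>

definition frac_minus :: "real \<Rightarrow> real \<Rightarrow> (nat \<Rightarrow> 'v::real_vector) \<Rightarrow> nat \<Rightarrow> 'v" where
  "frac_minus \<alpha> h Q k = (1 / h powr \<alpha>) *\<^sub>R (\<Sum>r=0..k. frac_coeff \<alpha> r *\<^sub>R Q (k - r))"

definition frac_plus :: "real \<Rightarrow> real \<Rightarrow> nat \<Rightarrow> (nat \<Rightarrow> 'v::real_vector) \<Rightarrow> nat \<Rightarrow> 'v" where
  "frac_plus \<alpha> h N Q k = (1 / h powr \<alpha>) *\<^sub>R (\<Sum>r=0..N - k. frac_coeff \<alpha> r *\<^sub>R Q (k + r))"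

definition along ::
  "(real^'d \<Rightarrow> real^'d \<Rightarrow> real \<Rightarrow> 'b) \<Rightarrow> real \<Rightarrow> real \<Rightarrow> real \<Rightarrow> nat \<Rightarrow> (nat \<Rightarrow> real^'d) \<Rightarrow> nat \<Rightarrow> 'b" where
  "along F \<alpha> a b N Q k = F (Q k) (frac_minus \<alpha> (step a b N) Q k) (node a b N k)"

definition solves_EL ::
  "(real^'d \<Rightarrow> real^'d \<Rightarrow> real \<Rightarrow> real) \<Rightarrow> real \<Rightarrow> real \<Rightarrow> real \<Rightarrow> nat \<Rightarrow> (nat \<Rightarrow> real^'d) \<Rightarrow> bool" where
  "solves_EL L \<alpha> a b N Q \<longleftrightarrow>
     (\<forall>k\<in>{1..N - 1}.
        along (dL_dx L) \<alpha> a b N Q k +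
        frac_plus \<alpha> (step a b N) N (along (dL_dv L) \<alpha> a b N Q) k = 0)"

definition frac_invariant ::
  "(real^'d \<Rightarrow> real^'d \<Rightarrow> real \<Rightarrow> real) \<Rightarrow> real \<Rightarrow> real \<Rightarrow> real \<Rightarrow> nat \<Rightarrow> (real \<Rightarrow> real^'d \<Rightarrow> real^'d) \<Rightarrow> bool" where
  "frac_invariant L \<alpha> a b N \<phi> \<longleftrightarrow>
     (\<forall>Q. solves_EL L \<alpha> a b N Q \<longrightarrow>
        (\<forall>s. \<forall>k\<in>{1..N}. along L \<alpha> a b N (\<lambda>j. \<phi> s (Q j)) k = along L \<alpha> a b N Q k))"

definition shift :: "nat \<Rightarrow> (nat \<Rightarrow> 'v::zero) \<Rightarrow> nat \<Rightarrow> 'v" where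
  "shift N Q k = (if k < N then Q (Suc k) else 0)"

text \<open>
  \<open>noether_mat N r\<close> is the matrix \<open>A\<^sub>r\<close>, of size \<open>N + 1\<close> with indices \<open>0, \<dots>, N\<close>, for
  \<open>1 \<le> r \<le> N - 1\<close>. For \<open>r \<ge> 2\<close> row \<open>N\<close> is a copy of row \<open>N - 1\<close>. This is not so for
  \<open>A\<^sub>1 = -Id\<close>, which is why the conserved quantity built below from these matrices is in general
  constant only over the indices \<open>0, \<dots>, N - 1\<close>: for \<open>N \<ge> 2\<close> its increment from \<open>N - 1\<close> to \<open>N\<close> is
  \<open>-\<alpha> (dphi0 \<phi> (Q (N - 1)) \<bullet> G N)\<close> with \<open>G = along (dL_dv L) \<alpha> a b N Q\<close>.
\<close>

definition noether_row :: "nat \<Rightarrow> nat \<Rightarrow> nat \<Rightarrow> nat \<Rightarrow> real" where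
  "noether_row N r i j =
     of_bool (j = 0) * of_bool (r \<le> i) -
     of_bool (j \<le> i \<and> i - j \<le> r - 1) * of_bool (1 \<le> j \<and> j \<le> N - r)"

definition noether_mat :: "nat \<Rightarrow> nat \<Rightarrow> nat \<Rightarrow> nat \<Rightarrow> real" where
  "noether_mat N r i j =
     (if r = 1 then - of_bool (i = j)
      else if i = 0 then 0
      else if i \<le> N - 1 then noether_row N r i j
      else noether_row N r (N - 1) j)"

definition mat_apply :: "nat \<Rightarrow> (nat \<Rightarrow> nat \<Rightarrow> real) \<Rightarrow> (nat \<Rightarrow> real) \<Rightarrow> nat \<Rightarrow> real" where
  "mat_apply N A X i = (\<Sum>j=0..N. A i j * X j)"

definition noether_quantity ::
  "(real^'d \<Rightarrow> real^'d \<Rightarrow> real \<Rightarrow> real) \<Rightarrow> real \<Rightarrow> real \<Rightarrow> real \<Rightarrow> nat \<Rightarrow> (real \<Rightarrow> real^'d \<Rightarrow> real^'d) \<Rightarrow>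
   (nat \<Rightarrow> real^'d) \<Rightarrow> nat \<Rightarrow> real" where
  "noether_quantity L \<alpha> a b N \<phi> Q i =
     (\<Sum>r=1..N - 1. frac_coeff \<alpha> r *
        mat_apply N (noether_mat N r)
          (\<lambda>k. dphi0 \<phi> (Q k) \<bullet> (shift N ^^ r) (along (dL_dv L) \<alpha> a b N Q) k) i)"

end

theory Submission
  imports Defs
begin

text \<open>
  Differentiating the invariance of \<open>L\<close> along \<open>Q\<close> with respect to the group parameter at \<open>s = 0\<close>
  gives, with \<open>Y = \<partial>\<phi>/\<partial>s(0, Q)\<close>, \<open>G = \<partial>L/\<partial>v\<close> and \<open>\<partial>L/\<partial>x\<close> replaced by the Euler--Lagrange equation,
  the discrete transfer identity
  \<open>G\<^sub>k \<bullet> (\<Delta>\<^sub>- Y)\<^sub>k = (\<Delta>\<^sub>+ G)\<^sub>k \<bullet> Y\<^sub>k\<close> for \<open>1 \<le> k \<le> N - 1\<close>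
  (\<open>fractional_transfer_identity\<close>). The terms with \<open>r = 0\<close> agree on both sides. What remains is that
  the sum over \<open>r = 1, \<dots>, N - 1\<close> of \<open>\<alpha>\<^sub>r\<close> times \<open>X\<^sub>k\<^sub>-\<^sub>r - X\<^sub>k\<close> vanishes, where for each \<open>r\<close> the sequence
  \<open>X = Y \<bullet> \<sigma>\<^sup>r G\<close> pairs \<open>Y\<close> with the momentum \<open>r\<close> places later, and terms with an index outside
  \<open>0, \<dots>, N\<close> count as \<open>0\<close>.

  Each term is a first difference: formally, \<open>X\<^sub>k\<^sub>-\<^sub>r - X\<^sub>k\<close> is the increment from \<open>k - 1\<close> to \<open>k\<close> of
  minus the sum of \<open>X\<close> over the \<open>r\<close> indices up to \<open>k\<close>. The matrix \<open>A\<^sub>r\<close> computes these window sums,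
  with the column \<open>0\<close> adapted to the start of the grid. On the columns where \<open>\<sigma>\<^sup>r G\<close> does not vanish,
  the difference of its rows \<open>k\<close> and \<open>k - 1\<close> is therefore \<open>1\<close> at column \<open>k - r\<close>, \<open>-1\<close> at column \<open>k\<close>
  and \<open>0\<close> elsewhere (\<open>noether_mat_row_difference\<close>). Hence the increment of the Noether quantity
  from \<open>k - 1\<close> to \<open>k\<close> is exactly the vanishing sum.
\<close>

section \<open>Differentiating the Lagrangian along a curve\<close>

lemma gradient_of_has_derivative:
  fixes f :: "'a::euclidean_space \<Rightarrow> real"
  assumes "(f has_derivative f') (at x)"
  shows "f' h = h \<bullet> gradient f x"
proof -
  have lin: "linear f'"
    using assms by (rule has_derivative_linear)
  \<comment> \<open>The Riesz representative of the functional \<open>f'\<close>.\<close>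
  define D where "D = adjoint f' 1"
  have D: "h \<bullet> D = f' h" for h
    using adjoint_works[OF lin, of h 1] by (simp add: D_def)
  have "GDERIV f x :> D"
    unfolding gderiv_def using assms by (simp add: D)
  moreover have "E = D" if "GDERIV f x :> E" for E
  proof -
    have "(\<lambda>h. h \<bullet> E) = f'"
      using that assms unfolding gderiv_def by (rule has_derivative_unique)
    then have "h \<bullet> E = h \<bullet> D" for h
      using D by (metis (no_types))
    then show "E = D"
      by (metis vector_eq_ldot)
  qed
  ultimately have "gradient f x = D"
    unfolding gradient_def by (rule the_equality)
  then show ?thesis
    using D by simp
qed

text \<open>
  The time \<open>t\<close> is held fixed, so the curve never leaves \<open>UNIV \<times> UNIV \<times> {a..b}\<close>. This is why the derivative
  of \<open>L\<close> within that set suffices, also at the ends of the interval.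
\<close>

lemma lagrangian_chain_rule:
  fixes L :: "real^'d \<Rightarrow> real^'d \<Rightarrow> real \<Rightarrow> real"
  assumes L: "lagrangian a b L" and t: "t \<in> {a..b}"
    and x: "(x has_vector_derivative x') (at s)"
    and v: "(v has_vector_derivative v') (at s)"
  shows "((\<lambda>s. L (x s) (v s) t) has_real_derivative
           x' \<bullet> dL_dx L (x s) (v s) t + v' \<bullet> dL_dv L (x s) (v s) t) (at s)"
proof -
  let ?S = "UNIV \<times> UNIV \<times> {a..b}"
  obtain F where F: "\<And>p. p \<in> ?S \<Longrightarrow>
      ((\<lambda>(x, v, t). L x v t) has_derivative blinfun_apply (F p)) (at p within ?S)"
    using L unfolding lagrangian_def C2_on_def by blast
  let ?F = "blinfun_apply (F (x s, v s, t))"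
  have FL: "((\<lambda>(x, v, t). L x v t) has_derivative ?F) (at (x s, v s, t) within T)"
    if "T \<subseteq> ?S" for T
    using has_derivative_subset[OF F that] t by auto
  have "((\<lambda>y. case (y, v s, t) of (x, v, t) \<Rightarrow> L x v t) has_derivative (\<lambda>h. ?F (h, 0, 0))) (at (x s))"
    by (rule has_derivative_in_compose[where f = "\<lambda>y. (y, v s, t)"])
       (use t in \<open>auto simp: zero_prod_def intro!: derivative_eq_intros FL\<close>)
  then have Fx: "?F (h, 0, 0) = h \<bullet> dL_dx L (x s) (v s) t" for h
    unfolding dL_dx_def by (intro gradient_of_has_derivative) simp
  have "((\<lambda>w. case (x s, w, t) of (x, v, t) \<Rightarrow> L x v t) has_derivative (\<lambda>h. ?F (0, h, 0))) (at (v s))"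
    by (rule has_derivative_in_compose[where f = "\<lambda>w. (x s, w, t)"])
       (use t in \<open>auto simp: zero_prod_def intro!: derivative_eq_intros FL\<close>)
  then have Fv: "?F (0, h, 0) = h \<bullet> dL_dv L (x s) (v s) t" for h
    unfolding dL_dv_def by (intro gradient_of_has_derivative) simp
  have "((\<lambda>s. case (x s, v s, t) of (x, v, t) \<Rightarrow> L x v t) has_derivative
          (\<lambda>h. ?F (h *\<^sub>R x', h *\<^sub>R v', 0))) (at s)"
    by (rule has_derivative_in_compose[where f = "\<lambda>s. (x s, v s, t)"])
       (use t x v in \<open>auto simp: has_vector_derivative_def intro!: has_derivative_Pair FL\<close>)
  moreover have "?F (h *\<^sub>R x', h *\<^sub>R v', 0) =
      (x' \<bullet> dL_dx L (x s) (v s) t + v' \<bullet> dL_dv L (x s) (v s) t) * h" for h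
  proof -
    have "(h *\<^sub>R x', h *\<^sub>R v', 0::real) = h *\<^sub>R ((x', 0, 0) + (0, v', 0))"
      by simp
    then have "?F (h *\<^sub>R x', h *\<^sub>R v', 0) = h * (?F (x', 0, 0) + ?F (0, v', 0))"
      by (simp only: blinfun.scaleR_right blinfun.add_right real_scaleR_def)
    then show ?thesis
      by (simp add: Fx Fv mult.commute)
  qed
  ultimately show ?thesis
    unfolding has_field_derivative_def by simp
qed

lemma one_param_group_has_vector_derivative:
  assumes "one_param_group \<phi>"
  shows "((\<lambda>s. \<phi> s x) has_vector_derivative dphi0 \<phi> x) (at 0)"
proof -
  obtain F where F: "((\<lambda>(s, x). \<phi> s x) has_derivative blinfun_apply (F p)) (at p)" for p
    using assms unfolding one_param_group_def C2_on_def by auto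
  have "((\<lambda>s. case (s, x) of (s, x) \<Rightarrow> \<phi> s x) has_derivative
          (\<lambda>h. blinfun_apply (F (0, x)) (h, 0))) (at 0)"
    by (rule has_derivative_compose[where f = "\<lambda>s. (s, x)"])
       (auto intro!: derivative_eq_intros F)
  then have "(\<lambda>s. \<phi> s x) differentiable (at 0)"
    by (auto intro: differentiableI)
  then show ?thesis
    unfolding dphi0_def by (simp add: vector_derivative_works)
qed

section \<open>The transfer identity\<close>

lemma node_mem_interval:
  assumes "a < b" "k \<le> N" "N \<ge> 1"
  shows "node a b N k \<in> {a..b}"
proof -
  have "real k * ((b - a) / real N) \<le> real N * ((b - a) / real N)"
    using assms by (intro mult_right_mono) auto
  then show ?thesis
    using assms by (auto simp: node_def step_def)
qed

lemma frac_minus_has_vector_derivative: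
  assumes "\<And>j. ((\<lambda>s. X s j) has_vector_derivative Y j) (at s)"
  shows "((\<lambda>s. frac_minus \<alpha> h (X s) k) has_vector_derivative frac_minus \<alpha> h Y k) (at s)"
  unfolding frac_minus_def
  by (intro bounded_linear.has_vector_derivative[OF bounded_linear_scaleR_right]
      has_vector_derivative_sum assms)

text \<open>
  The right-hand side of the invariance does not depend on \<open>s\<close>, so the derivative of the left-hand
  side at \<open>s = 0\<close> vanishes. The Euler--Lagrange equation trades the position gradient in it for a
  forward difference of the momenta.
\<close>

lemma fractional_transfer_identity:
  fixes L :: "real^'d \<Rightarrow> real^'d \<Rightarrow> real \<Rightarrow> real"
  assumes "a < b" and "lagrangian a b L" and \<phi>: "one_param_group \<phi>"
    and inv: "frac_invariant L \<alpha> a b N \<phi>" and EL: "solves_EL L \<alpha> a b N Q"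
    and k: "k \<in> {1..N - 1}"
  defines "Y \<equiv> \<lambda>j. dphi0 \<phi> (Q j)" and "G \<equiv> along (dL_dv L) \<alpha> a b N Q"
  shows "frac_minus \<alpha> (step a b N) Y k \<bullet> G k = Y k \<bullet> frac_plus \<alpha> (step a b N) N G k"
proof -
  let ?h = "step a b N"
  have \<phi>0: "\<phi> 0 y = y" for y
    using \<phi> by (simp add: one_param_group_def)
  have Y: "((\<lambda>s. \<phi> s (Q j)) has_vector_derivative Y j) (at 0)" for j
    unfolding Y_def using \<phi> by (rule one_param_group_has_vector_derivative)
  have \<Delta>Y: "((\<lambda>s. frac_minus \<alpha> ?h (\<lambda>j. \<phi> s (Q j)) k) has_vector_derivative
      frac_minus \<alpha> ?h Y k) (at 0)"
    using Y by (rule frac_minus_has_vector_derivative)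
  have t: "node a b N k \<in> {a..b}"
    using \<open>a < b\<close> k by (intro node_mem_interval) auto
  have "((\<lambda>s. L (\<phi> s (Q k)) (frac_minus \<alpha> ?h (\<lambda>j. \<phi> s (Q j)) k) (node a b N k)) has_real_derivative
      Y k \<bullet> along (dL_dx L) \<alpha> a b N Q k + frac_minus \<alpha> ?h Y k \<bullet> G k) (at 0)"
    using lagrangian_chain_rule[OF \<open>lagrangian a b L\<close> t Y[of k] \<Delta>Y]
    by (simp add: \<phi>0 along_def G_def)
  moreover have "(\<lambda>s. L (\<phi> s (Q k)) (frac_minus \<alpha> ?h (\<lambda>j. \<phi> s (Q j)) k) (node a b N k)) =
      (\<lambda>s. along L \<alpha> a b N Q k)"
  proof
    fix s
    have "k \<in> {1..N}"
      using k by auto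
    then show "L (\<phi> s (Q k)) (frac_minus \<alpha> ?h (\<lambda>j. \<phi> s (Q j)) k) (node a b N k) = along L \<alpha> a b N Q k"
      using inv EL unfolding frac_invariant_def along_def by blast
  qed
  ultimately have "Y k \<bullet> along (dL_dx L) \<alpha> a b N Q k + frac_minus \<alpha> ?h Y k \<bullet> G k = 0"
    by (metis DERIV_const DERIV_unique)
  moreover have "along (dL_dx L) \<alpha> a b N Q k = - frac_plus \<alpha> ?h N G k"
    using EL k unfolding solves_EL_def G_def by (metis add_eq_0_iff2)
  ultimately show ?thesis
    by (simp add: inner_minus_right)
qed

section \<open>The Noether matrices as discrete primitives\<close>

lemma shift_funpow:
  assumes "k \<le> N"
  shows "(shift N ^^ r) G k = (if k + r \<le> N then G (k + r) else 0)"
  using assms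
proof (induction r arbitrary: k)
  case 0
  then show ?case by simp
next
  case (Suc r)
  then show ?case
    using Suc.IH[of "Suc k"] by (simp add: shift_def)
qed

text \<open>
  Columns \<open>j > N - r\<close> are left out because every sequence \<open>\<sigma>\<^sup>r G\<close> vanishes there. For \<open>r \<ge> 2\<close>
  the matrix is zero on those columns, so an entry \<open>-1\<close> at \<open>j = k\<close> would be wrong, and row
  \<open>0\<close> is no exception to the formula for the other rows, which gives \<open>0\<close> there too.
\<close>

lemma noether_mat_row_difference:
  assumes "k \<in> {1..N - 1}" "r \<in> {1..N - 1}" "j + r \<le> N"
  shows "noether_mat N r k j - noether_mat N r (k - 1) j = of_bool (j + r = k) - of_bool (j = k)"
proof (cases "r = 1")
  case True
  then show ?thesis
    using assms by (simp add: noether_mat_def of_bool_def) arith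
next
  case False
  then have r: "2 \<le> r"
    using assms by simp
  obtain i where i: "k = Suc i"
    using assms by (cases k) auto
  have row: "noether_mat N r k j - noether_mat N r (k - 1) j =
      noether_row N r k j - noether_row N r i j"
    using assms(1) r i by (simp add: noether_mat_def noether_row_def)
  show ?thesis
  proof (cases "j = 0")
    \<comment> \<open>The column \<open>0\<close> lies outside every window. Its entries jump once, in row \<open>r\<close>, to produce \<open>X\<^sub>0\<close>.\<close>
    case True
    then show ?thesis
      unfolding row using i by (auto simp: noether_row_def)
  next
    case False
    \<comment> \<open>The window of row \<open>k\<close> is that of row \<open>k - 1\<close> with column \<open>k\<close> gained and column \<open>k - r\<close> lost.\<close>
    have "(j \<le> k \<and> k - j \<le> r - 1) \<longleftrightarrow> (j \<le> k \<and> k < j + r)"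
        "(j \<le> i \<and> i - j \<le> r - 1) \<longleftrightarrow> (j < k \<and> k \<le> j + r)"
      using r i by linarith+
    moreover have "1 \<le> j \<and> j \<le> N - r"
      using False assms by simp
    ultimately have "noether_row N r k j = - of_bool (j \<le> k \<and> k < j + r)"
        "noether_row N r i j = - of_bool (j < k \<and> k \<le> j + r)"
      using False by (simp_all add: noether_row_def)
    moreover have "of_bool (j < k \<and> k \<le> j + r) - of_bool (j \<le> k \<and> k < j + r) =
        (of_bool (j + r = k) - of_bool (j = k) :: real)"
      using r by (cases k j rule: linorder_cases; cases k "j + r" rule: linorder_cases) simp_all
    ultimately show ?thesis
      unfolding row by linarith
  qed
qed

lemma mat_apply_noether_mat_increment:
  assumes k: "k \<in> {1..N - 1}" and r: "r \<in> {1..N - 1}"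
    and X: "\<And>j. j \<le> N \<Longrightarrow> N < j + r \<Longrightarrow> X j = 0"
  shows "mat_apply N (noether_mat N r) X k - mat_apply N (noether_mat N r) X (k - 1) =
           (if r \<le> k then X (k - r) else 0) - X k"
proof -
  have "mat_apply N (noether_mat N r) X k - mat_apply N (noether_mat N r) X (k - 1) =
      (\<Sum>j=0..N. (noether_mat N r k j - noether_mat N r (k - 1) j) * X j)"
    by (simp add: mat_apply_def sum_subtractf left_diff_distrib)
  also have "\<dots> = (\<Sum>j=0..N. (of_bool (j + r = k) - of_bool (j = k)) * X j)"
  proof (rule sum.cong)
    fix j assume "j \<in> {0..N}"
    then show "(noether_mat N r k j - noether_mat N r (k - 1) j) * X j =
        (of_bool (j + r = k) - of_bool (j = k)) * X j"
      by (cases "j + r \<le> N") (use X[of j] noether_mat_row_difference[OF k r, of j] in auto)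
  qed simp
  also have "\<dots> = (\<Sum>j=0..N. if j + r = k then X j else 0) - (\<Sum>j=0..N. if j = k then X j else 0)"
    by (simp add: left_diff_distrib sum_subtractf of_bool_def if_distrib[of "\<lambda>c. c * _"] cong: if_cong)
  also have "(\<Sum>j=0..N. if j = k then X j else 0) = X k"
    using k by auto
  also have "(\<Sum>j=0..N. if j + r = k then X j else 0) = (if r \<le> k then X (k - r) else 0)"
  proof (cases "r \<le> k")
    case True
    then have "(\<Sum>j=0..N. if j + r = k then X j else 0) = (\<Sum>j=0..N. if j = k - r then X j else 0)"
      by (intro sum.cong) auto
    then show ?thesis
      using True k by auto
  qed (auto intro!: sum.neutral)
  finally show ?thesis .
qed

section \<open>Conservation\<close>

text \<open>
  \<open>frac_coeff 1 r\<close> is \<open>1\<close>, \<open>-1\<close> for \<open>r = 0\<close>, \<open>1\<close> and vanishes for \<open>r \<ge> 2\<close>, since the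
  product defining it then contains the factor \<open>1 - \<alpha>\<close> with \<open>\<alpha> = 1\<close>.
\<close>

lemma frac_minus_1:
  fixes X :: "nat \<Rightarrow> 'v::real_vector"
  assumes "k \<ge> 1"
  shows "frac_minus 1 h X k = (1 / h powr 1) *\<^sub>R (X k - X (k - 1))"
proof -
  have "frac_coeff 1 r = 0" if "r \<ge> 2" for r
  proof -
    have "\<exists>k<r. (-1 :: real) = - of_nat k"
      using that by (intro exI[of _ 1]) simp
    then show ?thesis
      by (simp add: frac_coeff_def pochhammer_eq_0_iff)
  qed
  then have "(\<Sum>r=0..k. frac_coeff 1 r *\<^sub>R X (k - r)) = (\<Sum>r\<in>{0, 1}. frac_coeff 1 r *\<^sub>R X (k - r))"
    using assms by (intro sum.mono_neutral_right) auto
  then show ?thesis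
    by (simp add: frac_minus_def frac_coeff_def)
qed

theorem theorem10:
  fixes a b \<alpha> :: real and N :: nat
    and L :: "real^'d \<Rightarrow> real^'d \<Rightarrow> real \<Rightarrow> real"
    and \<phi> :: "real \<Rightarrow> real^'d \<Rightarrow> real^'d"
    and Q :: "nat \<Rightarrow> real^'d"
  assumes "a < b" and "N \<ge> 1" and "0 < \<alpha>" and "\<alpha> \<le> 1"
    and "lagrangian a b L"
    and "one_param_group \<phi>"
    and "frac_invariant L \<alpha> a b N \<phi>"
    and "solves_EL L \<alpha> a b N Q"
  shows "\<forall>k\<in>{1..N - 1}. frac_minus 1 (step a b N) (noether_quantity L \<alpha> a b N \<phi> Q) k = 0"
proof
  fix k assume k: "k \<in> {1..N - 1}"
  define Y where "Y = (\<lambda>j. dphi0 \<phi> (Q j))"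
  define G where "G = along (dL_dv L) \<alpha> a b N Q"
  define X where "X = (\<lambda>r j. Y j \<bullet> (shift N ^^ r) G j)"
  let ?c = "frac_coeff \<alpha>" and ?h = "step a b N"
  have X: "X r j = (if j + r \<le> N then Y j \<bullet> G (j + r) else 0)" if "j \<le> N" for r j
    using that by (simp add: X_def shift_funpow)
  have "?h powr \<alpha> \<noteq> 0"
    using \<open>a < b\<close> \<open>N \<ge> 1\<close> by (simp add: step_def)
  then have "(\<Sum>r=0..k. ?c r * (Y (k - r) \<bullet> G k)) = (\<Sum>r=0..N - k. ?c r * (Y k \<bullet> G (k + r)))"
    using fractional_transfer_identity[OF assms(1,5-8) k]
    by (simp add: frac_minus_def frac_plus_def Y_def G_def inner_sum_left inner_sum_right)
  then have transfer: "(\<Sum>r=1..k. ?c r * (Y (k - r) \<bullet> G k)) = (\<Sum>r=1..N - k. ?c r * (Y k \<bullet> G (k + r)))"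
    by (simp add: sum.atLeast_Suc_atMost[of 0])
  \<comment> \<open>Both sums may be extended to \<open>1, \<dots>, N - 1\<close>, since the zero padding kills the new terms.\<close>
  have past: "(\<Sum>r=1..N - 1. ?c r * (if r \<le> k then X r (k - r) else 0)) =
      (\<Sum>r=1..k. ?c r * (Y (k - r) \<bullet> G k))"
    using k by (intro sum.mono_neutral_cong_right) (auto simp: X)
  have future: "(\<Sum>r=1..N - 1. ?c r * X r k) = (\<Sum>r=1..N - k. ?c r * (Y k \<bullet> G (k + r)))"
    using k by (intro sum.mono_neutral_cong_right) (auto simp: X split: if_splits)
  have "noether_quantity L \<alpha> a b N \<phi> Q k - noether_quantity L \<alpha> a b N \<phi> Q (k - 1) =
      (\<Sum>r=1..N - 1. ?c r *
        (mat_apply N (noether_mat N r) (X r) k - mat_apply N (noether_mat N r) (X r) (k - 1)))"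
    by (simp add: noether_quantity_def X_def Y_def G_def sum_subtractf right_diff_distrib)
  also have "\<dots> = (\<Sum>r=1..N - 1. ?c r * ((if r \<le> k then X r (k - r) else 0) - X r k))"
    using k by (intro sum.cong refl arg_cong[where f = "(*) _"] mat_apply_noether_mat_increment)
      (auto simp: X)
  also have "\<dots> = 0"
    using past future transfer by (simp add: right_diff_distrib sum_subtractf)
  finally show "frac_minus 1 ?h (noether_quantity L \<alpha> a b N \<phi> Q) k = 0"
    using k by (simp add: frac_minus_1)
qed

end
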